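(* For all modal trees $\mathtt{T},\mathtt{T}'$: if $\mathtt{T}\hookrightarrow^{*}\mathtt{T}'$ in the tree rewriting system $\mathsf{TRC}$, then $\mathscr{F}(\mathtt{T})\vdash_{\mathbf{RC}}\mathscr{F}(\mathtt{T}')$.
   Context: Strictly positive formulas $\mathcal{L}^+$: $\varphi::=\top\mid p\mid\langle\alpha\rangle\varphi\mid(\varphi\wedge\varphi)$ with $p$ a propositional variable and $\alpha<\omega$. Sequents $\varphi\vdash\psi$. $\mathbf{K}^+$ has axioms $\varphi\vdash\varphi$, $\varphi\vdash\top$, $\varphi\wedge\psi\vdash\varphi$, $\varphi\wedge\psi\vdash\psi$, and rules: from $\varphi\vdash\psi$ and $\psi\vdash\chi$ infer $\varphi\vdash\chi$; from $\varphi\vdash\psi$ and $\varphi\vdash\chi$ infer $\varphi\vdash\psi\wedge\chi$; from $\varphi\vdash\psi$ infer $\langle\alpha\rangle\varphi\vdash\langle\alpha\rangle\psi$. The Reflection Calculus $\mathbf{RC}$ extends $\mathbf{K}^+$ by axioms $\langle\alpha\rangle\langle\alpha\rangle\varphi\vdash\langle\alpha\rangle\varphi$; $\langle\alpha\rangle\varphi\vdash\langle\beta\rangle\varphi$ for $\alpha>\beta$; $\langle\alpha\rangle\varphi\wedge\langle\beta\rangle\psi\vdash\langle\alpha\rangle(\varphi\wedge\langle\beta\rangle\psi)$ for $\alpha>\beta$. Modal trees: recursively, pairs $\langle\Delta;\Gamma\rangle$ with $\Delta$ a finite list of propositional variables and $\Gamma$ a finite list of pairs $(\alpha,\mathtt{S})$,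 $\alpha<\omega$, $\mathtt{S}$ a modal tree. For a finite list $\Pi$ of formulas, $\bigwedge\varnothing=\top$ and $\bigwedge(\varphi\frown\Pi)=\varphi\wedge\bigwedge\Pi$. $\mathscr{F}(\langle\Delta;\Gamma\rangle):=\bigwedge\Delta\wedge\bigwedge[\langle\alpha\rangle\mathscr{F}(\mathtt{S})\mid(\alpha,\mathtt{S})\in\Gamma]$. Positions: $\mathrm{Pos}(\langle\Delta;\varnothing\rangle)=\{\epsilon\}$; $\mathrm{Pos}(\langle\Delta;[(\alpha_1,\mathtt{S}_1),\dots,(\alpha_n,\mathtt{S}_n)]\rangle)=\{\epsilon\}\cup\bigcup_{i=1}^n\{i\mathbf{k}\mid\mathbf{k}\in\mathrm{Pos}(\mathtt{S}_i)\}$. Subtree: $\mathtt{T}|_\epsilon=\mathtt{T}$, $\mathtt{T}|_{i\mathbf{r}}=\mathtt{S}_i|_{\mathbf{r}}$. Replacement: $\mathtt{T}[\mathtt{S}]_\epsilon=\mathtt{S}$, $\mathtt{T}[\mathtt{S}]_{i\mathbf{r}}$ is $\mathtt{T}$ with its $i$-th child $\mathtt{S}_i$ replaced by $\mathtt{S}_i[\mathtt{S}]_{\mathbf{r}}$ (same edge label). List operations, for $\Gamma$ a list and $0<i,j\le|\Gamma|$: $\#_i\Gamma$ is the $i$-th element; $\Gamma^{-i}$ deletes it; $\Gamma^{+i}=(\#_i\Gamma)\frown\Gamma$; $\Gamma[x]_i$ replaces the $i$-th element by $x$; $\Gamma^{i\leftrightarrow j}$ swaps the $i$-th and $j$-th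 elements; similarly $\Delta^{-n},\Delta^{+n}$ for node labels. $\mathsf{TRC}$ rules: for a modal tree $\mathtt{T}$, $\mathbf{k}\in\mathrm{Pos}(\mathtt{T})$ with $\mathtt{T}|_\mathbf{k}=\langle\Delta;\Gamma\rangle$: ($\rho^+$) $\mathtt{T}\hookrightarrow\mathtt{T}[\langle\Delta^{+i};\Gamma\rangle]_\mathbf{k}$, $0<i\le|\Delta|$; ($\rho^-$) $\mathtt{T}\hookrightarrow\mathtt{T}[\langle\Delta^{-i};\Gamma\rangle]_\mathbf{k}$; ($\sigma$) $\mathtt{T}\hookrightarrow\mathtt{T}[\langle\Delta;\Gamma^{i\leftrightarrow j}\rangle]_\mathbf{k}$, $i\neq j$; ($\pi^+$) $\mathtt{T}\hookrightarrow\mathtt{T}[\langle\Delta;\Gamma^{+i}\rangle]_\mathbf{k}$; ($\pi^-$) $\mathtt{T}\hookrightarrow\mathtt{T}[\langle\Delta;\Gamma^{-i}\rangle]_\mathbf{k}$; ($\mathfrak{4}$) if $\#_i\Gamma=(\beta,\langle\tilde\Delta;\tilde\Gamma\rangle)$ and $\#_j\tilde\Gamma=(\beta,\mathtt{S})$, then $\mathtt{T}\hookrightarrow\mathtt{T}[\langle\Delta;\Gamma[(\beta,\mathtt{S})]_i\rangle]_\mathbf{k}$; ($\lambda$) if $\#_i\Gamma=(\alpha,\mathtt{S})$ and $\alpha>\beta$, then $\mathtt{T}\hookrightarrow\mathtt{T}[\langle\Delta;\Gamma[(\beta,\mathtt{S})]_i\rangle]_\mathbf{k}$; ($\mathsf{J}$)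 if $i\ne j$, $\#_i\Gamma=(\alpha,\langle\tilde\Delta;\tilde\Gamma\rangle)$, $\#_j\Gamma=(\beta,\mathtt{S})$, $\alpha>\beta$, then $\mathtt{T}\hookrightarrow\mathtt{T}[\langle\Delta;(\Gamma[(\alpha,\langle\tilde\Delta;\tilde\Gamma\frown(\beta,\mathtt{S})\rangle)]_i)^{-j}\rangle]_\mathbf{k}$. $\hookrightarrow$ is the union of these relations and $\hookrightarrow^*$ its reflexive-transitive closure. *)

theory Defs
  imports Main
begin

datatype 'p form =
    Top
  | Var 'p
  | Dia nat "'p form"
  | Conj "'p form" "'p form"

inductive RC :: "'p form \<Rightarrow> 'p form \<Rightarrow> bool" (infix "\<turnstile>\<^sub>R\<^sub>C" 50) where
  refl: "\<phi> \<turnstile>\<^sub>R\<^sub>C \<phi>"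
| top: "\<phi> \<turnstile>\<^sub>R\<^sub>C Top"
| conjE1: "Conj \<phi> \<psi> \<turnstile>\<^sub>R\<^sub>C \<phi>"
| conjE2: "Conj \<phi> \<psi> \<turnstile>\<^sub>R\<^sub>C \<psi>"
| cut: "\<phi> \<turnstile>\<^sub>R\<^sub>C \<psi> \<Longrightarrow> \<psi> \<turnstile>\<^sub>R\<^sub>C \<chi> \<Longrightarrow> \<phi> \<turnstile>\<^sub>R\<^sub>C \<chi>"
| conjI: "\<phi> \<turnstile>\<^sub>R\<^sub>C \<psi> \<Longrightarrow> \<phi> \<turnstile>\<^sub>R\<^sub>C \<chi> \<Longrightarrow> \<phi> \<turnstile>\<^sub>R\<^sub>C Conj \<psi> \<chi>"
| nec: "\<phi> \<turnstile>\<^sub>R\<^sub>C \<psi> \<Longrightarrow> Dia \<alpha> \<phi> \<turnstile>\<^sub>R\<^sub>C Dia \<alpha> \<psi>"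
| trans: "Dia \<alpha> (Dia \<alpha> \<phi>) \<turnstile>\<^sub>R\<^sub>C Dia \<alpha> \<phi>"
| mono: "\<alpha> > \<beta> \<Longrightarrow> Dia \<alpha> \<phi> \<turnstile>\<^sub>R\<^sub>C Dia \<beta> \<phi>"
| J: "\<alpha> > \<beta> \<Longrightarrow> Conj (Dia \<alpha> \<phi>) (Dia \<beta> \<psi>) \<turnstile>\<^sub>R\<^sub>C Dia \<alpha> (Conj \<phi> (Dia \<beta> \<psi>))"

datatype 'p mtree = Node "'p list" "(nat \<times> 'p mtree) list"

primrec big_conj :: "'p form list \<Rightarrow> 'p form" where
  "big_conj [] = Top"
| "big_conj (\<phi> # \<Pi>) = Conj \<phi> (big_conj \<Pi>)"

fun form_of :: "'p mtree \<Rightarrow> 'p form" where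
  "form_of (Node \<Delta> \<Gamma>) =
     Conj (big_conj (map Var \<Delta>)) (big_conj (map (\<lambda>(\<alpha>, S). Dia \<alpha> (form_of S)) \<Gamma>))"

text \<open>List positions, and hence tree positions, count from 1. The operations below are
  meaningful only for indices between 1 and the length of the list; every use in the rewriting
  rules is guarded accordingly.\<close>

definition index_of :: "'a list \<Rightarrow> nat set" where
  "index_of xs = {i. 0 < i \<and> i \<le> length xs}"

definition elem_at :: "nat \<Rightarrow> 'a list \<Rightarrow> 'a" where
  "elem_at i xs = xs ! (i - 1)"

definition delete_at :: "nat \<Rightarrow> 'a list \<Rightarrow> 'a list" where
  "delete_at i xs = take (i - 1) xs @ drop i xs"

definition duplicate_at :: "nat \<Rightarrow> 'a list \<Rightarrow> 'a list" where
  "duplicate_at i xs = elem_at i xs # xs"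

definition replace_at :: "nat \<Rightarrow> 'a \<Rightarrow> 'a list \<Rightarrow> 'a list" where
  "replace_at i x xs = xs[i - 1 := x]"

definition swap_at :: "nat \<Rightarrow> nat \<Rightarrow> 'a list \<Rightarrow> 'a list" where
  "swap_at i j xs = replace_at j (elem_at i xs) (replace_at i (elem_at j xs) xs)"

lemma size_child:
  assumes "i \<in> index_of \<Gamma>"
  shows "size (snd (elem_at i \<Gamma>)) < size (Node \<Delta> \<Gamma>)"
proof -
  have "elem_at i \<Gamma> \<in> set \<Gamma>"
    using assms by (auto simp: index_of_def elem_at_def)
  then have "size_prod (\<lambda>_. 0) size (elem_at i \<Gamma>) \<le> size_list (size_prod (\<lambda>_. 0) size) \<Gamma>"
    by (rule size_list_estimation') simp
  then show ?thesis
    by (cases "elem_at i \<Gamma>") simp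
qed

function Pos :: "'p mtree \<Rightarrow> nat list set" where
  "Pos (Node \<Delta> \<Gamma>) =
     {[]} \<union> (\<Union>i\<in>index_of \<Gamma>. {i # k | k. k \<in> Pos (snd (elem_at i \<Gamma>))})"
  by pat_completeness auto
termination
  by (relation "measure size") (auto intro: size_child simp del: mtree.size)

primrec subtree :: "nat list \<Rightarrow> 'p mtree \<Rightarrow> 'p mtree" where
  "subtree [] T = T"
| "subtree (i # r) T = (case T of Node \<Delta> \<Gamma> \<Rightarrow> subtree r (snd (elem_at i \<Gamma>)))"

text \<open>\<open>replace_subtree k S T\<close> is the replacement of the subtree of \<open>T\<close> at position \<open>k\<close> by \<open>S\<close>.\<close>

primrec replace_subtree :: "nat list \<Rightarrow> 'p mtree \<Rightarrow> 'p mtree \<Rightarrow> 'p mtree" where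
  "replace_subtree [] S T = S"
| "replace_subtree (i # r) S T =
     (case T of Node \<Delta> \<Gamma> \<Rightarrow>
        (case elem_at i \<Gamma> of (\<alpha>, T\<^sub>i) \<Rightarrow>
           Node \<Delta> (replace_at i (\<alpha>, replace_subtree r S T\<^sub>i) \<Gamma>)))"

inductive TRC :: "'p mtree \<Rightarrow> 'p mtree \<Rightarrow> bool" (infix "\<hookrightarrow>" 50) where
  rho_plus:
    "\<lbrakk>k \<in> Pos T; subtree k T = Node \<Delta> \<Gamma>; i \<in> index_of \<Delta>\<rbrakk>
     \<Longrightarrow> T \<hookrightarrow> replace_subtree k (Node (duplicate_at i \<Delta>) \<Gamma>) T"
| rho_minus:
    "\<lbrakk>k \<in> Pos T; subtree k T = Node \<Delta> \<Gamma>; i \<in> index_of \<Delta>\<rbrakk>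
     \<Longrightarrow> T \<hookrightarrow> replace_subtree k (Node (delete_at i \<Delta>) \<Gamma>) T"
| sigma:
    "\<lbrakk>k \<in> Pos T; subtree k T = Node \<Delta> \<Gamma>; i \<in> index_of \<Gamma>; j \<in> index_of \<Gamma>; i \<noteq> j\<rbrakk>
     \<Longrightarrow> T \<hookrightarrow> replace_subtree k (Node \<Delta> (swap_at i j \<Gamma>)) T"
| pi_plus:
    "\<lbrakk>k \<in> Pos T; subtree k T = Node \<Delta> \<Gamma>; i \<in> index_of \<Gamma>\<rbrakk>
     \<Longrightarrow> T \<hookrightarrow> replace_subtree k (Node \<Delta> (duplicate_at i \<Gamma>)) T"
| pi_minus:
    "\<lbrakk>k \<in> Pos T; subtree k T = Node \<Delta> \<Gamma>; i \<in> index_of \<Gamma>\<rbrakk>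
     \<Longrightarrow> T \<hookrightarrow> replace_subtree k (Node \<Delta> (delete_at i \<Gamma>)) T"
| four:
    "\<lbrakk>k \<in> Pos T; subtree k T = Node \<Delta> \<Gamma>;
      i \<in> index_of \<Gamma>; elem_at i \<Gamma> = (\<beta>, Node \<Delta>' \<Gamma>');
      j \<in> index_of \<Gamma>'; elem_at j \<Gamma>' = (\<beta>, S)\<rbrakk>
     \<Longrightarrow> T \<hookrightarrow> replace_subtree k (Node \<Delta> (replace_at i (\<beta>, S) \<Gamma>)) T"
| lambda:
    "\<lbrakk>k \<in> Pos T; subtree k T = Node \<Delta> \<Gamma>;
      i \<in> index_of \<Gamma>; elem_at i \<Gamma> = (\<alpha>, S); \<alpha> > \<beta>\<rbrakk>
     \<Longrightarrow> T \<hookrightarrow> replace_subtree k (Node \<Delta> (replace_at i (\<beta>, S) \<Gamma>)) T"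
| J:
    "\<lbrakk>k \<in> Pos T; subtree k T = Node \<Delta> \<Gamma>;
      i \<in> index_of \<Gamma>; j \<in> index_of \<Gamma>; i \<noteq> j;
      elem_at i \<Gamma> = (\<alpha>, Node \<Delta>' \<Gamma>'); elem_at j \<Gamma> = (\<beta>, S); \<alpha> > \<beta>\<rbrakk>
     \<Longrightarrow> T \<hookrightarrow> replace_subtree k
           (Node \<Delta> (delete_at j (replace_at i (\<alpha>, Node \<Delta>' (\<Gamma>' @ [(\<beta>, S)])) \<Gamma>))) T"

abbreviation TRC_star :: "'p mtree \<Rightarrow> 'p mtree \<Rightarrow> bool" (infix "\<hookrightarrow>\<^sup>*" 50) where
  "T \<hookrightarrow>\<^sup>* T' \<equiv> TRC\<^sup>*\<^sup>* T T'"

end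

theory Submission
  imports Defs
begin

text \<open>\<open>form_of (Node \<Delta> \<Gamma>)\<close> is, up to provable equivalence, the meet of the \<^emph>\<open>sets\<close> of formulas
  contributed by \<open>\<Delta>\<close> and \<open>\<Gamma>\<close>. So a rewriting step at the root is sound as soon as every label and
  edge of the result follows from the original tree, which is immediate for the structural rules
  and an instance of the corresponding modal axiom for the others. Monotonicity of the
  diamonds carries this over to arbitrary positions.\<close>

lemma big_conjE: "\<phi> \<in> set \<Pi> \<Longrightarrow> big_conj \<Pi> \<turnstile>\<^sub>R\<^sub>C \<phi>"
  by (induction \<Pi>) (auto intro: RC.conjE1 RC.cut[OF RC.conjE2])

lemma big_conjI: "(\<And>\<psi>. \<psi> \<in> set \<Pi> \<Longrightarrow> \<phi> \<turnstile>\<^sub>R\<^sub>C \<psi>) \<Longrightarrow> \<phi> \<turnstile>\<^sub>R\<^sub>C big_conj \<Pi>"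
  by (induction \<Pi>) (auto intro: RC.top RC.conjI)

lemma form_of_NodeE_Var: "p \<in> set \<Delta> \<Longrightarrow> form_of (Node \<Delta> \<Gamma>) \<turnstile>\<^sub>R\<^sub>C Var p"
  by (simp add: RC.cut[OF RC.conjE1 big_conjE])

lemma form_of_NodeE_Dia:
  assumes "(\<alpha>, S) \<in> set \<Gamma>"
  shows "form_of (Node \<Delta> \<Gamma>) \<turnstile>\<^sub>R\<^sub>C Dia \<alpha> (form_of S)"
proof -
  have "Dia \<alpha> (form_of S) \<in> set (map (\<lambda>(\<alpha>, S). Dia \<alpha> (form_of S)) \<Gamma>)"
    using assms by force
  from RC.cut[OF RC.conjE2 big_conjE[OF this]] show ?thesis
    by simp
qed

lemma form_of_NodeI:
  assumes "\<And>p. p \<in> set \<Delta> \<Longrightarrow> \<phi> \<turnstile>\<^sub>R\<^sub>C Var p"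
    and "\<And>\<alpha> S. (\<alpha>, S) \<in> set \<Gamma> \<Longrightarrow> \<phi> \<turnstile>\<^sub>R\<^sub>C Dia \<alpha> (form_of S)"
  shows "\<phi> \<turnstile>\<^sub>R\<^sub>C form_of (Node \<Delta> \<Gamma>)"
  using assms by (auto intro!: RC.conjI big_conjI)

text \<open>Edges already in \<open>\<Gamma>\<close> are derivable from the original node, so only
  those in the set difference carry an obligation. Taking differences of sets makes order and
  multiplicity irrelevant, and a local rewriting step leaves at most one edge to justify.\<close>

lemma form_of_NodeI_diff:
  assumes "set \<Delta>' \<subseteq> set \<Delta>"
    and "\<And>\<alpha> S. (\<alpha>, S) \<in> set \<Gamma>' - set \<Gamma> \<Longrightarrow> form_of (Node \<Delta> \<Gamma>) \<turnstile>\<^sub>R\<^sub>C Dia \<alpha> (form_of S)"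
  shows "form_of (Node \<Delta> \<Gamma>) \<turnstile>\<^sub>R\<^sub>C form_of (Node \<Delta>' \<Gamma>')"
proof (rule form_of_NodeI)
  fix p assume "p \<in> set \<Delta>'"
  with assms(1) show "form_of (Node \<Delta> \<Gamma>) \<turnstile>\<^sub>R\<^sub>C Var p"
    by (intro form_of_NodeE_Var) (rule subsetD)
next
  fix \<alpha> S assume "(\<alpha>, S) \<in> set \<Gamma>'"
  then show "form_of (Node \<Delta> \<Gamma>) \<turnstile>\<^sub>R\<^sub>C Dia \<alpha> (form_of S)"
    by (cases "(\<alpha>, S) \<in> set \<Gamma>") (simp_all del: form_of.simps add: assms(2) form_of_NodeE_Dia)
qed

lemma form_of_Node_subset:
  assumes "set \<Delta>' \<subseteq> set \<Delta>" "set \<Gamma>' \<subseteq> set \<Gamma>"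
  shows "form_of (Node \<Delta> \<Gamma>) \<turnstile>\<^sub>R\<^sub>C form_of (Node \<Delta>' \<Gamma>')"
  using assms by (intro form_of_NodeI_diff) auto

text \<open>Updating a list adds at most the entry \<open>(\<alpha>, S)\<close> to its set, so that
  edge is the only one to derive. This serves both the rules that rewrite a single edge and the
  passage from a subtree to its parent.\<close>

lemma form_of_replace_at:
  assumes "form_of (Node \<Delta> \<Gamma>) \<turnstile>\<^sub>R\<^sub>C Dia \<alpha> (form_of S)"
  shows "form_of (Node \<Delta> \<Gamma>) \<turnstile>\<^sub>R\<^sub>C form_of (Node \<Delta> (replace_at i (\<alpha>, S) \<Gamma>))"
  using assms set_update_subset_insert[of \<Gamma> "i - 1" "(\<alpha>, S)"]
  by (intro form_of_NodeI_diff) (auto simp: replace_at_def simp del: form_of.simps)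

lemma elem_at_in_set: "i \<in> index_of xs \<Longrightarrow> elem_at i xs \<in> set xs"
  by (auto simp: index_of_def elem_at_def)

lemma set_delete_at: "set (delete_at i xs) \<subseteq> set xs"
  by (auto simp: delete_at_def dest: in_set_takeD in_set_dropD)

lemma set_duplicate_at: "i \<in> index_of xs \<Longrightarrow> set (duplicate_at i xs) \<subseteq> set xs"
  by (auto simp: duplicate_at_def elem_at_in_set)

lemma set_swap_at:
  "i \<in> index_of xs \<Longrightarrow> j \<in> index_of xs \<Longrightarrow> set (swap_at i j xs) \<subseteq> set xs"
  by (auto simp: swap_at_def replace_at_def elem_at_in_set
      dest!: subsetD[OF set_update_subset_insert])

text \<open>Induction along the position: necessitation lifts the sequent for the child
  \<open>U\<close> through the edge labelled \<open>\<alpha>\<close>, and the parent then differs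
  from the original in that one edge only.\<close>

lemma form_of_replace_subtree:
  assumes "k \<in> Pos T" "form_of (subtree k T) \<turnstile>\<^sub>R\<^sub>C form_of S"
  shows "form_of T \<turnstile>\<^sub>R\<^sub>C form_of (replace_subtree k S T)"
  using assms
proof (induction k arbitrary: T)
  case (Cons i r)
  obtain \<Delta> \<Gamma> where T: "T = Node \<Delta> \<Gamma>" by (cases T)
  obtain \<alpha> U where U: "elem_at i \<Gamma> = (\<alpha>, U)" by fastforce
  from Cons.prems(1) have i: "i \<in> index_of \<Gamma>" and "r \<in> Pos U"
    by (auto simp: T U)
  then have "form_of U \<turnstile>\<^sub>R\<^sub>C form_of (replace_subtree r S U)"
    using Cons.IH Cons.prems(2) by (simp add: T U)
  moreover have "(\<alpha>, U) \<in> set \<Gamma>"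
    using elem_at_in_set[OF i] by (simp add: U)
  ultimately have "form_of (Node \<Delta> \<Gamma>) \<turnstile>\<^sub>R\<^sub>C Dia \<alpha> (form_of (replace_subtree r S U))"
    using RC.cut[OF form_of_NodeE_Dia RC.nec] by metis
  from form_of_replace_at[OF this, of i] show ?case
    by (simp add: T U del: form_of.simps)
qed simp

lemma TRC_sound:
  assumes "T \<hookrightarrow> T'"
  shows "form_of T \<turnstile>\<^sub>R\<^sub>C form_of T'"
  using assms
proof cases
  case (four k \<Delta> \<Gamma> i \<beta> \<Delta>' \<Gamma>' j S)
  have "(\<beta>, Node \<Delta>' \<Gamma>') \<in> set \<Gamma>" "(\<beta>, S) \<in> set \<Gamma>'"
    using four elem_at_in_set by metis+
  then have "form_of (Node \<Delta> \<Gamma>) \<turnstile>\<^sub>R\<^sub>C Dia \<beta> (form_of S)"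
    \<comment> \<open>The outer edge, followed under necessitation by the inner one, yields
      \<open>Dia \<beta> (Dia \<beta> (form_of S))\<close>, which transitivity collapses.\<close>
    by (intro RC.cut[OF form_of_NodeE_Dia RC.cut[OF RC.nec[OF form_of_NodeE_Dia] RC.trans]])
  then show ?thesis
    using four by (metis form_of_replace_subtree form_of_replace_at)
next
  case (lambda k \<Delta> \<Gamma> i \<alpha> S \<beta>)
  have "(\<alpha>, S) \<in> set \<Gamma>"
    using lambda elem_at_in_set by metis
  then have "form_of (Node \<Delta> \<Gamma>) \<turnstile>\<^sub>R\<^sub>C Dia \<beta> (form_of S)"
    using lambda by (intro RC.cut[OF form_of_NodeE_Dia RC.mono])
  then show ?thesis
    using lambda by (metis form_of_replace_subtree form_of_replace_at)
next
  case (J k \<Delta> \<Gamma> i j \<alpha> \<Delta>' \<Gamma>' \<beta> S)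
  note [trans] = RC.cut
  let ?U = "Node \<Delta>' \<Gamma>'" and ?U' = "Node \<Delta>' (\<Gamma>' @ [(\<beta>, S)])"
  have "(\<alpha>, ?U) \<in> set \<Gamma>" "(\<beta>, S) \<in> set \<Gamma>"
    using J elem_at_in_set by metis+
  then have "form_of (Node \<Delta> \<Gamma>) \<turnstile>\<^sub>R\<^sub>C Conj (Dia \<alpha> (form_of ?U)) (Dia \<beta> (form_of S))"
    by (intro RC.conjI form_of_NodeE_Dia)
  also have "\<dots> \<turnstile>\<^sub>R\<^sub>C Dia \<alpha> (Conj (form_of ?U) (Dia \<beta> (form_of S)))"
    using J by (intro RC.J)
  \<comment> \<open>The J axiom has moved the \<open>\<beta>\<close>-diamond under
    \<open>\<alpha>\<close>. There it supplies exactly the edge that \<open>?U'\<close> has beyond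
    \<open>?U\<close>.\<close>
  also have "\<dots> \<turnstile>\<^sub>R\<^sub>C Dia \<alpha> (form_of ?U')"
  proof (intro RC.nec form_of_NodeI)
    fix p assume "p \<in> set \<Delta>'"
    then show "Conj (form_of ?U) (Dia \<beta> (form_of S)) \<turnstile>\<^sub>R\<^sub>C Var p"
      by (rule RC.cut[OF RC.conjE1 form_of_NodeE_Var])
  next
    fix \<gamma> V assume "(\<gamma>, V) \<in> set (\<Gamma>' @ [(\<beta>, S)])"
    then show "Conj (form_of ?U) (Dia \<beta> (form_of S)) \<turnstile>\<^sub>R\<^sub>C Dia \<gamma> (form_of V)"
      by (auto simp del: form_of.simps
          intro: RC.conjE2 RC.cut[OF RC.conjE1 form_of_NodeE_Dia])
  qed
  finally have "form_of (Node \<Delta> \<Gamma>)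
      \<turnstile>\<^sub>R\<^sub>C form_of (Node \<Delta> (replace_at i (\<alpha>, ?U') \<Gamma>))"
    by (rule form_of_replace_at)
  \<comment> \<open>Removing the edge that was absorbed into \<open>?U'\<close> is a separate
    weakening, applied after the update.\<close>
  also have "\<dots>
      \<turnstile>\<^sub>R\<^sub>C form_of (Node \<Delta> (delete_at j (replace_at i (\<alpha>, ?U') \<Gamma>)))"
    by (intro form_of_Node_subset set_delete_at order.refl)
  finally show ?thesis
    using J by (metis form_of_replace_subtree)
\<comment> \<open>The five structural rules remain. They only copy, drop or permute labels or edges,
  so neither set grows.\<close>
qed (auto simp del: form_of.simps
      intro!: form_of_replace_subtree form_of_Node_subset
      dest: subsetD[OF set_delete_at] subsetD[OF set_duplicate_at] subsetD[OF set_swap_at])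

theorem mainTheorem1:
  fixes T T' :: "'p mtree"
  assumes "T \<hookrightarrow>\<^sup>* T'"
  shows "form_of T \<turnstile>\<^sub>R\<^sub>C form_of T'"
  using assms
proof induction
  case base
  show ?case by (rule RC.refl)
next
  case (step U V)
  show ?case by (rule RC.cut[OF step.IH TRC_sound[OF step.hyps(2)]])
qed

end
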